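(* As $k\to\infty$ (over positive integers $k$), $$T(k,k)-\frac{k}{2}\left(\ln k + \ln 4 + \gamma \right) \to 0,$$ where $\gamma = 0.5772\dots$ is the Euler--Mascheroni constant.
   Context: Mabinogion urn model (M-process): an urn contains white and black balls. At each time $1,2,3,\dots$ one ball is drawn uniformly at random from the urn, independently of previous selections, its color is observed and it is returned. If the drawn ball is white, one black ball is replaced by a white one; if the drawn ball is black, one white ball is replaced by a black one. The process stops when all balls are of the same color. Let $W_n,B_n$ be the numbers of white and black balls after $n$ transitions; thus $(W_n,B_n)$ is a Markov chain which, from a state $(w,b)$ with $w,b>0$, moves to $(w+1,b-1)$ with probability $\frac{w}{w+b}$ and to $(w-1,b+1)$ with probability $\frac{b}{w+b}$; states with $w=0$ or $b=0$ are absorbing. Let $H:=\min\{n: W_n=0 \text{ or } B_n=0\}$ and let $T(w,b):=\mathbf{E}(H\mid W_0=w,B_0=b)$ be the expected time to absorption. *)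

theory Defs
  imports "HOL-Probability.Probability"
begin

text \<open>
  States are pairs \<open>(w, b)\<close> of the numbers of white and black balls. The balls in the urn are
  numbered \<open>0, \<dots>, w + b - 1\<close>, the first \<open>w\<close> of them being the white ones; the second argument
  of \<open>urn_step\<close> is the number of the drawn ball.
\<close>

definition urn_step :: "nat \<times> nat \<Rightarrow> nat \<Rightarrow> nat \<times> nat" where
  "urn_step = (\<lambda>(w, b) i.
     if w = 0 \<or> b = 0 then (w, b)
     else if i < w then (w + 1, b - 1)
     else (w - 1, b + 1))"

primrec urn :: "nat \<times> nat \<Rightarrow> nat stream \<Rightarrow> nat \<Rightarrow> nat \<times> nat" where
  "urn s \<omega> 0 = s"
| "urn s \<omega> (Suc n) = urn_step (urn s \<omega> n) (\<omega> !! n)"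

text \<open>
  The total number of balls never changes, so the numbers of the drawn balls are i.i.d. uniform
  on \<open>{..<w + b}\<close>, where \<open>(w, b)\<close> is the initial state.
\<close>

definition draw :: "nat \<Rightarrow> nat \<Rightarrow> nat pmf" where
  "draw w b = pmf_of_set {..<w + b}"

definition draws :: "nat \<Rightarrow> nat \<Rightarrow> nat stream measure" where
  "draws w b = stream_space (measure_pmf (draw w b))"

text \<open>The infimum is \<open>\<infinity>\<close> if the process is never absorbed.\<close>

definition absorption_time :: "nat \<times> nat \<Rightarrow> nat stream \<Rightarrow> enat" where
  "absorption_time s \<omega> = Inf {enat n | n. fst (urn s \<omega> n) = 0 \<or> snd (urn s \<omega> n) = 0}"

definition expected_absorption_time :: "nat \<Rightarrow> nat \<Rightarrow> ennreal" where
  "expected_absorption_time w b =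
     (\<integral>\<^sup>+ \<omega>. ennreal_of_enat (absorption_time (w, b) \<omega>) \<partial>draws w b)"

lemma urn_total: "fst (urn s \<omega> n) + snd (urn s \<omega> n) = fst s + snd s"
  by (induction n) (auto simp: urn_step_def split: prod.splits)

lemma urn_transition_probabilities:
  assumes "w > 0" "b > 0"
  shows "pmf (map_pmf (urn_step (w, b)) (draw w b)) (w + 1, b - 1) = real w / real (w + b)"
    and "pmf (map_pmf (urn_step (w, b)) (draw w b)) (w - 1, b + 1) = real b / real (w + b)"
proof -
  have ne: "{..<w + b} \<noteq> {}" using assms by auto
  have up: "{..<w + b} \<inter> urn_step (w, b) -` {(w + 1, b - 1)} = {..<w}"
    using assms by (auto simp: urn_step_def split: if_splits)
  have down: "{..<w + b} \<inter> urn_step (w, b) -` {(w - 1, b + 1)} = {w..<w + b}"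
    using assms by (auto simp: urn_step_def split: if_splits)
  show "pmf (map_pmf (urn_step (w, b)) (draw w b)) (w + 1, b - 1) = real w / real (w + b)"
    unfolding pmf_map draw_def using up by (simp add: measure_pmf_of_set[OF ne])
  show "pmf (map_pmf (urn_step (w, b)) (draw w b)) (w - 1, b + 1) = real b / real (w + b)"
    unfolding pmf_map draw_def using down by (simp add: measure_pmf_of_set[OF ne])
qed

end

theory Submission
  imports Defs "HOL-Real_Asymp.Real_Asymp"
begin

text \<open>
  Condition on the first draw: a bounded nonnegative function that vanishes at absorption and
  solves the first-step equations is the expected absorption time. By symmetry the solution on
  \<open>2 k\<close> balls is a function of \<open>\<bar>w - k\<bar>\<close>, and its successive differences, divided by \<open>k\<close>, satisfy
  a first-order recurrence starting from \<open>1 / k\<close> at the centre. These differences for \<open>k\<close> and \<open>k + 1\<close>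
  are linearly related, so the change of their sum telescopes to \<open>1 / (2 k + 1)\<close>. Hence
  \<open>T(k, k) = k (1 + 1/3 + \<dots> + 1/(2 k - 1))\<close>, and the asymptotics of the harmonic numbers up to
  the term \<open>1 / (2 n)\<close> give the claim.
\<close>

section \<open>Expected absorption time as a sum of survival probabilities\<close>

definition absorbed :: "nat \<times> nat \<Rightarrow> bool" where
  "absorbed s \<longleftrightarrow> fst s = 0 \<or> snd s = 0"

lemma absorbed_urn_mono: "absorbed (urn s \<omega> m) \<Longrightarrow> m \<le> n \<Longrightarrow> absorbed (urn s \<omega> n)"
  by (induction n) (auto simp: absorbed_def urn_step_def le_Suc_eq split: prod.splits)

text \<open>Absorbed states are never left, so survival up to time \<open>n\<close> can be read off
  from the state at time \<open>n\<close> alone.\<close>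

lemma less_absorption_time_iff: "enat n < absorption_time s \<omega> \<longleftrightarrow> \<not> absorbed (urn s \<omega> n)"
proof
  assume less: "enat n < absorption_time s \<omega>"
  show "\<not> absorbed (urn s \<omega> n)"
  proof
    assume "absorbed (urn s \<omega> n)"
    then have "absorption_time s \<omega> \<le> enat n"
      unfolding absorption_time_def by (intro Inf_lower) (auto simp: absorbed_def)
    with less show False by simp
  qed
next
  assume alive: "\<not> absorbed (urn s \<omega> n)"
  have "enat (Suc n) \<le> absorption_time s \<omega>"
    unfolding absorption_time_def
  proof (rule Inf_greatest)
    fix x
    assume "x \<in> {enat m | m. fst (urn s \<omega> m) = 0 \<or> snd (urn s \<omega> m) = 0}"
    then obtain m where m: "x = enat m" "absorbed (urn s \<omega> m)" by (auto simp: absorbed_def)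
    then have "\<not> m \<le> n" using alive absorbed_urn_mono by blast
    then show "enat (Suc n) \<le> x" by (simp add: m)
  qed
  then show "enat n < absorption_time s \<omega>"
    by (simp add: Suc_ile_eq)
qed

lemma urn_Cons: "urn s (x ## \<omega>) (Suc n) = urn (urn_step s x) \<omega> n"
  by (induction n) auto

lemma measurable_urn [measurable]:
  "(\<lambda>\<omega>. urn s \<omega> n) \<in> stream_space (measure_pmf p) \<rightarrow>\<^sub>M count_space UNIV"
proof (induction n)
  case (Suc n)
  have "(\<lambda>\<omega>. urn_step (urn s \<omega> n) (\<omega> !! n)) \<in> stream_space (measure_pmf p) \<rightarrow>\<^sub>M count_space UNIV"
  \<comment> \<open>There are countably many states, so the current state may be held fixed.\<close>
  proof (rule measurable_compose_countable[OF _ Suc])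
    fix t
    show "(\<lambda>\<omega>. urn_step t (\<omega> !! n)) \<in> stream_space (measure_pmf p) \<rightarrow>\<^sub>M count_space UNIV"
      by measurable
  qed
  then show ?case by simp
qed simp

text \<open>The distribution \<open>p\<close> is kept separate from the start \<open>s\<close>: a
  transition changes the state but not the total number of balls, hence not the law of the
  draws.\<close>

definition urn_expectation :: "nat pmf \<Rightarrow> (nat \<times> nat \<Rightarrow> ennreal) \<Rightarrow> nat \<Rightarrow> nat \<times> nat \<Rightarrow> ennreal" where
  "urn_expectation p f n s = (\<integral>\<^sup>+ \<omega>. f (urn s \<omega> n) \<partial>stream_space (measure_pmf p))"

lemma prob_space_stream_space_pmf: "prob_space (stream_space (measure_pmf p))"
  by (intro prob_space.prob_space_stream_space prob_space_measure_pmf)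

lemma urn_expectation_0 [simp]: "urn_expectation p f 0 s = f s"
  using prob_space.emeasure_space_1[OF prob_space_stream_space_pmf, of p] by (simp add: urn_expectation_def)

text \<open>The Markov property: a stream of i.i.d. draws is a first draw followed by an independent
  stream of the same law.\<close>

lemma urn_expectation_Suc:
  "urn_expectation p f (Suc n) s = (\<integral>\<^sup>+ x. urn_expectation p f n (urn_step s x) \<partial>measure_pmf p)"
proof -
  have [measurable]: "(\<lambda>\<omega>. f (urn s \<omega> m)) \<in> borel_measurable (stream_space (measure_pmf p))" for m s
    by (rule measurable_compose[OF measurable_urn]) simp
  show ?thesis
    unfolding urn_expectation_def
    by (subst prob_space.nn_integral_stream_space[OF prob_space_measure_pmf])
       (simp_all only: urn_Cons, measurable)
qed

abbreviation alive :: "nat \<times> nat \<Rightarrow> ennreal" where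
  "alive s \<equiv> of_bool (\<not> absorbed s)"

lemma suminf_of_bool_less: "(\<Sum>n. of_bool (enat n < x)) = ennreal_of_enat x"
proof (cases x)
  case (enat k)
  have "(\<Sum>n. of_bool (enat n < x)) = (\<Sum>n<k. of_bool (enat n < x) :: ennreal)"
    by (rule suminf_finite) (auto simp: enat)
  also have "\<dots> = (\<Sum>n<k. 1)"
    by (rule sum.cong) (auto simp: enat)
  finally show ?thesis by (simp add: enat)
next
  case infinity
  have "(\<lambda>n. of_nat n :: ennreal) \<longlonglongrightarrow> (\<Sum>n. of_bool (enat n < x))"
    using summable_LIMSEQ[OF summableI, of "\<lambda>n. of_bool (enat n < x) :: ennreal"]
    by (simp add: infinity)
  then have "(\<Sum>n. of_bool (enat n < x) :: ennreal) = top"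
    using of_nat_tendsto_top_ennreal LIMSEQ_unique by blast
  then show ?thesis by (simp add: infinity)
qed

text \<open>The tail-sum formula: the expectation of \<open>alive\<close> at time \<open>n\<close>
  is the probability that absorption comes after \<open>n\<close>.\<close>

lemma expected_absorption_time_eq_suminf:
  "expected_absorption_time w b = (\<Sum>n. urn_expectation (draw w b) alive n (w, b))"
proof -
  have "expected_absorption_time w b
      = (\<integral>\<^sup>+ \<omega>. (\<Sum>n. alive (urn (w, b) \<omega> n)) \<partial>stream_space (measure_pmf (draw w b)))"
    by (simp add: expected_absorption_time_def draws_def less_absorption_time_iff
        flip: suminf_of_bool_less)
  also have "\<dots> = (\<Sum>n. urn_expectation (draw w b) alive n (w, b))"
    unfolding urn_expectation_def
    by (rule nn_integral_suminf) (rule measurable_compose[OF measurable_urn], simp)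
  finally show ?thesis .
qed

section \<open>Bounded solutions of the first-step equations\<close>

text \<open>Unrolling the first-step equation \<open>m\<close> times leaves the expectation of
  \<open>V\<close> at time \<open>m\<close> as remainder. The set \<open>S\<close> is closed under
  transitions, so the equation stays available after each draw.\<close>

lemma partial_sum_alive_plus_expectation:
  assumes "\<And>s. s \<in> S \<Longrightarrow> V s = alive s + (\<integral>\<^sup>+ x. V (urn_step s x) \<partial>measure_pmf p)"
    and "\<And>s x. s \<in> S \<Longrightarrow> urn_step s x \<in> S"
    and "s \<in> S"
  shows "(\<Sum>n<m. urn_expectation p alive n s) + urn_expectation p V m s = V s"
  using \<open>s \<in> S\<close>
proof (induction m arbitrary: s)
  case (Suc m)
  have "(\<Sum>n<Suc m. urn_expectation p alive n s) + urn_expectation p V (Suc m) s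
     = alive s + ((\<Sum>n<m. urn_expectation p alive (Suc n) s) + urn_expectation p V (Suc m) s)"
    by (simp only: sum.lessThan_Suc_shift urn_expectation_0 add.assoc)
  also have "\<dots> = alive s + (\<integral>\<^sup>+ x. (\<Sum>n<m. urn_expectation p alive n (urn_step s x))
      + urn_expectation p V m (urn_step s x) \<partial>measure_pmf p)"
    by (simp add: urn_expectation_Suc nn_integral_add nn_integral_sum)
  also have "\<dots> = alive s + (\<integral>\<^sup>+ x. V (urn_step s x) \<partial>measure_pmf p)"
    by (simp add: Suc.IH assms(2) Suc.prems)
  also have "\<dots> = V s" using assms(1) Suc.prems by simp
  finally show ?case .
qed simp

text \<open>The finite value \<open>V (w, b)\<close> bounds the partial sums of survival
  probabilities, so these probabilities tend to 0. As \<open>V\<close> is at most \<open>C\<close>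
  and vanishes on absorbed states, the remainder is at most \<open>C\<close> times the survival
  probability and disappears in the limit.\<close>

lemma expected_absorption_time_eqI:
  assumes V: "\<And>s. fst s + snd s = w + b \<Longrightarrow>
      V s = alive s + (\<integral>\<^sup>+ x. V (urn_step s x) \<partial>measure_pmf (draw w b))"
    and bound: "\<And>s. fst s + snd s = w + b \<Longrightarrow> V s \<le> ennreal C * alive s"
  shows "expected_absorption_time w b = V (w, b)"
proof -
  let ?P = "\<lambda>n. urn_expectation (draw w b) alive n (w, b)"
  let ?E = "\<lambda>n. urn_expectation (draw w b) V n (w, b)"
  have total: "fst (urn_step s x) + snd (urn_step s x) = w + b" if "fst s + snd s = w + b" for s x
    using that by (auto simp: urn_step_def split: prod.splits)
  have eq: "(\<Sum>n<m. ?P n) + ?E m = V (w, b)" for m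
    by (rule partial_sum_alive_plus_expectation[where S = "{s. fst s + snd s = w + b}"])
       (use V total in auto)
  have "V (w, b) \<le> ennreal C" using bound[of "(w, b)"] by (cases "absorbed (w, b)") auto
  then have fin: "V (w, b) < top" using ennreal_less_top le_less_trans by blast
  have sums: "(\<lambda>m. \<Sum>n<m. ?P n) \<longlonglongrightarrow> (\<Sum>n. ?P n)"
    by (intro summable_LIMSEQ summableI)
  have "(\<Sum>n. ?P n) \<le> V (w, b)"
    by (rule LIMSEQ_le_const2[OF sums]) (metis eq add_increasing2 zero_le order_refl)
  then have "(\<Sum>n. ?P n) \<noteq> top" using fin by auto
  have P0: "?P \<longlonglongrightarrow> 0"
  proof -
    \<comment> \<open>Each term is a difference of consecutive partial sums; subtraction in
      \<open>ennreal\<close> is safe here because all these sums are finite.\<close>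
    have "(\<lambda>m. (\<Sum>n<Suc m. ?P n) - (\<Sum>n<m. ?P n)) \<longlonglongrightarrow> (\<Sum>n. ?P n) - (\<Sum>n. ?P n)"
      by (intro tendsto_diff_ennreal LIMSEQ_Suc sums) (use \<open>(\<Sum>n. ?P n) \<noteq> top\<close> in auto)
    moreover have "(\<Sum>n<m. ?P n) \<noteq> top" for m
      using fin eq[of m] by (metis ennreal_add_eq_top less_irrefl)
    ultimately show ?thesis
      using \<open>(\<Sum>n. ?P n) \<noteq> top\<close> by simp
  qed
  have "?E n \<le> ennreal C * ?P n" for n
  proof -
    have "?E n \<le> (\<integral>\<^sup>+ \<omega>. ennreal C * alive (urn (w, b) \<omega> n) \<partial>stream_space (measure_pmf (draw w b)))"
      unfolding urn_expectation_def
      by (intro nn_integral_mono bound) (simp add: urn_total)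
    also have "\<dots> = ennreal C * ?P n"
      unfolding urn_expectation_def
      by (rule nn_integral_cmult) (rule measurable_compose[OF measurable_urn], simp)
    finally show ?thesis .
  qed
  moreover have "(\<lambda>n. ennreal C * ?P n) \<longlonglongrightarrow> 0"
    using ennreal_tendsto_cmult[OF _ P0, of "ennreal C"] by simp
  ultimately have "?E \<longlonglongrightarrow> 0"
    by (intro tendsto_sandwich[of "\<lambda>_. 0" ?E sequentially "\<lambda>n. ennreal C * ?P n"]) auto
  then have "(\<lambda>m. (\<Sum>n<m. ?P n) + ?E m) \<longlonglongrightarrow> (\<Sum>n. ?P n) + 0"
    by (intro tendsto_add sums)
  then have "(\<Sum>n. ?P n) = V (w, b)"
    unfolding eq by (simp add: LIMSEQ_const_iff)
  then show ?thesis by (simp add: expected_absorption_time_eq_suminf)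
qed

section \<open>Closed form for the sum of the gaps\<close>

text \<open>
  On \<open>2 k\<close> balls, \<open>k * gap k i\<close> is the drop of the expected absorption time from \<open>\<bar>w - k\<bar> = i\<close>
  to \<open>\<bar>w - k\<bar> = i + 1\<close>; it is meaningful only for \<open>i < k\<close>.
\<close>

primrec gap :: "nat \<Rightarrow> nat \<Rightarrow> real" where
  "gap k 0 = 1 / real k"
| "gap k (Suc i) = ((real k - 1 - real i) * gap k i + 2) / (real k + 1 + real i)"

lemma gap_nonneg: "i < k \<Longrightarrow> gap k i \<ge> 0"
  by (induction i) (auto intro!: divide_nonneg_nonneg add_nonneg_nonneg mult_nonneg_nonneg)

text \<open>A contiguity relation between the recurrences for \<open>k\<close> and
  \<open>Suc k\<close>. It propagates in \<open>i\<close> because each recurrence expresses the next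
  gap linearly in the current one.\<close>

lemma gap_Suc_left:
  assumes "k > 0" "i \<le> k"
  shows "2 * (real k - i) * (k + 1 + i) * gap (Suc k) i = k * (2 * k + 1) * gap k i - (2 * real i + 1)"
  using assms(2)
proof (induction i)
  case 0
  show ?case using assms(1) by (simp add: field_simps)
next
  case (Suc i)
  define x where "x = real i"
  define n where "n = real k"
  define a where "a = gap k i"
  define b where "b = gap (Suc k) i"
  define a' where "a' = gap k (Suc i)"
  define b' where "b' = gap (Suc k) (Suc i)"
  have n: "n > x" "x \<ge> 0" using Suc.prems by (auto simp: n_def x_def)
  have IH: "2 * (n - x) * (n + 1 + x) * b = n * (2 * n + 1) * a - (2 * x + 1)"
    using Suc by (simp add: x_def n_def a_def b_def add_ac)
  have step: "a' * (n + 1 + x) = (n - 1 - x) * a + 2" "b' * (n + 2 + x) = (n - x) * b + 2"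
    using n by (auto simp: x_def n_def a_def b_def a'_def b'_def add_ac)
  \<comment> \<open>The extra factor \<open>n + 1 + x\<close> is the denominator of
    \<open>a'\<close>; it makes the identity polynomial and, being positive, is cancelled
    afterwards.\<close>
  have "(2 * (n - 1 - x) * (n + 2 + x) * b') * (n + 1 + x)
     = 2 * (n - 1 - x) * ((n - x) * b + 2) * (n + 1 + x)"
    using step(2) by algebra
  also have "\<dots> = (n * (2 * n + 1) * a' - (2 * x + 3)) * (n + 1 + x)"
    using step(1) IH by algebra
  finally have "2 * (n - 1 - x) * (n + 2 + x) * b' = n * (2 * n + 1) * a' - (2 * x + 3)"
    using n by (subst (asm) mult_right_cancel) auto
  then show ?case
    unfolding a'_def [symmetric] b'_def [symmetric] by (simp add: x_def n_def algebra_simps)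
qed

lemma sum_gap: "(\<Sum>i<k. gap k i) = (\<Sum>j<k. 1 / (2 * real j + 1))"
proof (induction k)
  case (Suc k)
  show ?case
  proof (cases "k = 0")
    case False
    \<comment> \<open>a telescoping certificate, of the kind found by Zeilberger's algorithm\<close>
    define G where "G i = - real i * (k + 1 + i) * gap (Suc k) i" for i
    have "real k * (2 * real k + 1) * (gap (Suc k) i - gap k i) = G (Suc i) - G i + 1" if "i < k" for i
    proof -
      have 1: "gap (Suc k) (Suc i) * (real k + 2 + real i) = (real k - real i) * gap (Suc k) i + 2"
        by (auto simp: add_ac)
      have 2: "2 * (real k - real i) * (real k + 1 + real i) * gap (Suc k) i
          = real k * (2 * real k + 1) * gap k i - (2 * real i + 1)"
        using gap_Suc_left[of k i] False that by (simp add: add_ac del: gap.simps)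
      have 3: "G (Suc i) = - (real i + 1) * (real k + 2 + real i) * gap (Suc k) (Suc i)"
        "G i = - real i * (real k + 1 + real i) * gap (Suc k) i"
        by (simp_all add: G_def algebra_simps del: gap.simps)
      show ?thesis using 1 2 unfolding 3 by algebra
    qed
    then have "(\<Sum>i<k. real k * (2 * real k + 1) * (gap (Suc k) i - gap k i)) = (\<Sum>i<k. G (Suc i) - G i + 1)"
      by simp
    also have "\<dots> = G k + k"
      by (simp add: sum.distrib sum_lessThan_telescope del: gap.simps) (simp add: G_def)
    also have "(\<Sum>i<k. real k * (2 * real k + 1) * (gap (Suc k) i - gap k i))
       = real k * (2 * real k + 1) * ((\<Sum>i<k. gap (Suc k) i) - (\<Sum>i<k. gap k i))"
      by (simp only: sum_distrib_left right_diff_distrib sum_subtractf)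
    finally have "real k * ((2 * real k + 1) * ((\<Sum>i<k. gap (Suc k) i) - (\<Sum>i<k. gap k i)))
       = real k * (1 - (2 * real k + 1) * gap (Suc k) k)"
      by (simp add: G_def algebra_simps del: gap.simps)
    then have "(2 * real k + 1) * ((\<Sum>i<k. gap (Suc k) i) - (\<Sum>i<k. gap k i))
       = 1 - (2 * real k + 1) * gap (Suc k) k"
      using False by (subst (asm) mult_left_cancel) auto
    \<comment> \<open>The boundary term \<open>gap (Suc k) k\<close> is exactly the additional
      summand in the sum for \<open>Suc k\<close>, so the full increment is
      \<open>1 / (2 * real k + 1)\<close>.\<close>
    then have "(\<Sum>i<k. gap (Suc k) i) - (\<Sum>i<k. gap k i) = 1 / (2 * real k + 1) - gap (Suc k) k"
      by (simp add: field_simps del: gap.simps)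
    with Suc show ?thesis by simp
  qed simp
qed simp

section \<open>Asymptotics of the odd harmonic sums\<close>

text \<open>All reciprocals up to \<open>2 * k\<close> without the even ones, which add up to half
  of \<open>harm k\<close>.\<close>

lemma sum_inverse_odd: "(\<Sum>j<k. 1 / (2 * real j + 1)) = harm (2 * k) - harm k / 2"
  proof (induction k)
  case (Suc k)
  have "harm (2 * Suc k) = harm (2 * k) + 1 / (2 * real k + 1) + 1 / (2 * (real k + 1))"
    by (simp add: harm_Suc inverse_eq_divide add_ac)
  with Suc show ?case by (simp add: harm_Suc inverse_eq_divide add_ac add_divide_distrib)
qed (simp add: harm_def)

text \<open>The sum is later multiplied by \<open>k\<close>, so errors of order \<open>1 / k\<close>
  matter. Both bounds from \<open>euler_mascheroni_bounds\<close> tend to \<open>1 - 1 / 2\<close>,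
  since \<open>n * (ln (n + 1) - ln n)\<close> tends to 1.\<close>

lemma harm_second_order:
  "(\<lambda>n. real n * (harm n - ln (real n) - euler_mascheroni)) \<longlonglongrightarrow> 1 / 2"
proof (rule tendsto_sandwich)
  show "\<forall>\<^sub>F n in sequentially. real n * (ln (real n + 1) - ln (real n) - 1 / (2 * real n))
      \<le> real n * (harm n - ln (real n) - euler_mascheroni)"
    using eventually_gt_at_top[of 0]
  proof eventually_elim
    case (elim n)
    then show ?case using euler_mascheroni_bounds[of n]
      by (intro mult_left_mono) (auto simp: inverse_eq_divide add_ac)
  qed
  show "\<forall>\<^sub>F n in sequentially. real n * (harm n - ln (real n) - euler_mascheroni)
      \<le> real n * (ln (real n + 1) - ln (real n) - 1 / (2 * (real n + 1)))"
    using eventually_gt_at_top[of 0]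
  proof eventually_elim
    case (elim n)
    then show ?case using euler_mascheroni_bounds[of n]
      by (intro mult_left_mono) (auto simp: inverse_eq_divide add_ac)
  qed
qed real_asymp+

text \<open>With \<open>D\<close> the scaled error of \<open>harm\<close>, the expression equals
  \<open>(D (2 * k) - D k) / 2\<close> for positive \<open>k\<close>, and the two limits
  \<open>1 / 2\<close> cancel. The \<open>ln 4\<close> arises as \<open>2 * ln 2\<close> from
  \<open>ln (2 * k)\<close>.\<close>

lemma odd_harmonic_asymp:
  "(\<lambda>k. real k * (\<Sum>j<k. 1 / (2 * real j + 1))
      - real k / 2 * (ln (real k) + ln 4 + euler_mascheroni)) \<longlonglongrightarrow> 0"
proof -
  define D where "D n = real n * (harm n - ln (real n) - euler_mascheroni)" for n
  have "D \<longlonglongrightarrow> 1 / 2" unfolding D_def by (rule harm_second_order)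
  moreover have "(\<lambda>k. D (2 * k)) \<longlonglongrightarrow> 1 / 2"
    by (rule filterlim_compose[OF \<open>D \<longlonglongrightarrow> 1 / 2\<close>]) real_asymp
  ultimately have "(\<lambda>k. (D (2 * k) - D k) / 2) \<longlonglongrightarrow> (1 / 2 - 1 / 2) / 2"
    by (intro tendsto_intros) auto
  then have "(\<lambda>k. (D (2 * k) - D k) / 2) \<longlonglongrightarrow> 0" by simp
  then show ?thesis
  proof (rule Lim_transform_eventually)
    show "\<forall>\<^sub>F k in sequentially. (D (2 * k) - D k) / 2 = real k * (\<Sum>j<k. 1 / (2 * real j + 1))
      - real k / 2 * (ln (real k) + ln 4 + euler_mascheroni)"
      using eventually_gt_at_top[of 0]
    proof eventually_elim
      case (elim k)
      have "ln (4::real) = 2 * ln 2" using ln_realpow[of 2 2] by simp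
      then show ?case using elim
        unfolding sum_inverse_odd by (simp add: D_def ln_mult field_simps)
    qed
  qed
qed

section \<open>The solution on \<open>2 * k\<close> balls\<close>

text \<open>The candidate at distance \<open>m\<close> from the balanced state: the drops from
  \<open>m\<close> outwards, with the empty sum at \<open>m = k\<close> giving the value 0 at
  absorption.\<close>

definition mean_time :: "nat \<Rightarrow> nat \<Rightarrow> real" where
  "mean_time k m = real k * (\<Sum>i=m..<k. gap k i)"

lemma mean_time_nonneg: "mean_time k m \<ge> 0"
  by (auto simp: mean_time_def intro!: mult_nonneg_nonneg sum_nonneg gap_nonneg)

lemma mean_time_le: "mean_time k m \<le> mean_time k 0"
  unfolding mean_time_def by (intro mult_left_mono sum_mono2) (auto intro: gap_nonneg)

lemma mean_time_diff: "m < k \<Longrightarrow> mean_time k m = real k * gap k m + mean_time k (Suc m)"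
  by (simp add: mean_time_def sum.atLeast_Suc_lessThan distrib_left)

text \<open>From the balanced state either draw leads to distance 1.\<close>

lemma mean_time_first_step_0: "k > 0 \<Longrightarrow> mean_time k 0 = 1 + mean_time k 1"
  using mean_time_diff[of 0 k] by simp

text \<open>At distance \<open>m\<close> the majority colour has \<open>k + m\<close> of the
  \<open>2 * k\<close> balls, and drawing it moves outwards. Written in terms of drops, the equation
  is the recurrence of \<open>gap\<close>.\<close>

lemma mean_time_first_step:
  assumes "0 < m" "m < k"
  shows "mean_time k m
    = 1 + ((real k + real m) * mean_time k (m + 1) + (real k - real m) * mean_time k (m - 1)) / (2 * real k)"
proof -
  obtain i where m: "m = Suc i" using assms(1) gr0_conv_Suc by auto
  have "gap k m * (real k + real m) = (real k - real m) * gap k i + 2"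
    by (simp add: m field_simps)
  moreover have "mean_time k (m - 1) = real k * gap k i + mean_time k m"
    and "mean_time k m = real k * gap k m + mean_time k (m + 1)"
    using mean_time_diff[of i k] mean_time_diff[of m k] assms by (auto simp: m simp del: gap.simps)
  ultimately have "2 * real k * mean_time k m
    = 2 * real k + ((real k + real m) * mean_time k (m + 1) + (real k - real m) * mean_time k (m - 1))"
    by algebra
  then show ?thesis using assms by (simp add: field_simps)
qed

text \<open>The ball numbers split into the white ones below \<open>w\<close> and the black ones
  from \<open>w\<close> on. The draws come from the initial state \<open>(w', b')\<close>, which
  shares only its total with the current state.\<close>

lemma nn_integral_urn_step:
  fixes f :: "nat \<times> nat \<Rightarrow> real"
  assumes "w > 0" "b > 0" and "w + b = w' + b'" and "\<And>s. f s \<ge> 0"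
  shows "(\<integral>\<^sup>+ x. ennreal (f (urn_step (w, b) x)) \<partial>measure_pmf (draw w' b'))
    = ennreal ((real w * f (w + 1, b - 1) + real b * f (w - 1, b + 1)) / (real w + real b))"
proof -
  have "(\<Sum>x<w + b. f (urn_step (w, b) x)) = (\<Sum>x<w. f (urn_step (w, b) x)) + (\<Sum>x=w..<w + b. f (urn_step (w, b) x))"
    by (subst sum.union_disjoint [symmetric]) (auto intro!: sum.cong)
  also have "\<dots> = (\<Sum>x<w. f (w + 1, b - 1)) + (\<Sum>x=w..<w + b. f (w - 1, b + 1))"
    using assms(1,2) by (intro arg_cong2[where f = "(+)"] sum.cong) (auto simp: urn_step_def)
  finally have sum: "(\<Sum>x<w + b. f (urn_step (w, b) x)) = real w * f (w + 1, b - 1) + real b * f (w - 1, b + 1)"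
    by simp
  have "(\<integral>\<^sup>+ x. ennreal (f (urn_step (w, b) x)) \<partial>measure_pmf (draw w' b'))
      = (\<Sum>x<w + b. ennreal (f (urn_step (w, b) x))) / ennreal (real (w + b))"
    unfolding draw_def assms(3) [symmetric]
    using assms(1) by (subst nn_integral_pmf_of_set) (auto simp: ennreal_of_nat_eq_real_of_nat)
  also have "\<dots> = ennreal ((\<Sum>x<w + b. f (urn_step (w, b) x)) / real (w + b))"
    using assms(1,4) by (subst divide_ennreal [symmetric]) (auto simp: sum_nonneg)
  finally show ?thesis by (simp add: sum)
qed

lemma expected_absorption_time_diagonal:
  assumes "k > 0"
  shows "expected_absorption_time k k = ennreal (mean_time k 0)"
proof -
  \<comment> \<open>The case distinction computes \<open>\<bar>w - k\<bar>\<close> without truncated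
    subtraction.\<close>
  define v where "v s = mean_time k (if k \<le> fst s then fst s - k else k - fst s)" for s :: "nat \<times> nat"
  have v_nonneg: "v s \<ge> 0" for s by (simp add: v_def mean_time_nonneg)
  have v_absorbed: "v s = 0" if "absorbed s" "fst s + snd s = k + k" for s
    using that by (auto simp: v_def absorbed_def mean_time_def)
  have "expected_absorption_time k k = ennreal (v (k, k))"
  proof (rule expected_absorption_time_eqI)
    fix s :: "nat \<times> nat"
    assume total: "fst s + snd s = k + k"
    show "ennreal (v s) \<le> ennreal (mean_time k 0) * alive s"
      using v_absorbed[OF _ total] by (cases "absorbed s") (auto simp: v_def intro!: ennreal_leI mean_time_le)
    show "ennreal (v s) = alive s + (\<integral>\<^sup>+ x. ennreal (v (urn_step s x)) \<partial>measure_pmf (draw k k))"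
    proof (cases "absorbed s")
      case True
      then have "urn_step s x = s" for x by (auto simp: absorbed_def urn_step_def split: prod.splits)
      then show ?thesis using True by simp
    next
      case False
      obtain w b where s: "s = (w, b)" by (cases s)
      have wb: "w > 0" "b > 0" "w + b = k + k" using False total by (auto simp: s absorbed_def)
      then have rb: "real b = 2 * real k - real w" by linarith
      let ?r = "(real w * v (w + 1, b - 1) + real b * v (w - 1, b + 1)) / (real w + real b)"
      have "v s = 1 + ?r"
      \<comment> \<open>A white draw moves inwards when white is the minority and outwards when it
        is the majority, so the two neighbours swap roles between the cases.\<close>
      proof (cases w k rule: linorder_cases)
        case less
        define m where "m = k - w"
        have m: "0 < m" "m < k" "w = k - m" using less wb by (auto simp: m_def)
        have "v s = mean_time k m" "v (w + 1, b - 1) = mean_time k (m - 1)" "v (w - 1, b + 1) = mean_time k (m + 1)"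
          using m by (auto simp: v_def s intro!: arg_cong[of _ _ "mean_time k"])
        then show ?thesis using mean_time_first_step[OF m(1,2)] m
          by (simp add: rb of_nat_diff add_ac)
      next
        case equal
        then show ?thesis using mean_time_first_step_0[OF assms] assms
          by (simp add: v_def s rb field_simps)
      next
        case greater
        define m where "m = w - k"
        have m: "0 < m" "m < k" "w = k + m" using greater wb by (auto simp: m_def)
        have "v s = mean_time k m" "v (w + 1, b - 1) = mean_time k (m + 1)" "v (w - 1, b + 1) = mean_time k (m - 1)"
          using m by (auto simp: v_def s intro!: arg_cong[of _ _ "mean_time k"])
        then show ?thesis using mean_time_first_step[OF m(1,2)] m
          by (simp add: rb add_ac)
      qed
      moreover have "?r \<ge> 0" by (intro divide_nonneg_nonneg add_nonneg_nonneg mult_nonneg_nonneg v_nonneg) auto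
      ultimately have "ennreal (v s) = 1 + ennreal ?r" by simp
      also have "ennreal ?r = (\<integral>\<^sup>+ x. ennreal (v (urn_step s x)) \<partial>measure_pmf (draw k k))"
        unfolding s by (rule nn_integral_urn_step[OF wb v_nonneg, symmetric])
      finally show ?thesis using False by simp
    qed
  qed
  then show ?thesis by (simp add: v_def)
qed

theorem corollary2p1:
  "((\<lambda>k::nat. enn2ereal (expected_absorption_time k k)
      - ereal (real k / 2 * (ln (real k) + ln 4 + euler_mascheroni))) \<longlongrightarrow> 0) sequentially"
proof -
  have "((\<lambda>k. ereal (real k * (\<Sum>j<k. 1 / (2 * real j + 1))
      - real k / 2 * (ln (real k) + ln 4 + euler_mascheroni))) \<longlongrightarrow> 0) sequentially"
    using odd_harmonic_asymp by (simp add: zero_ereal_def)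
  then show ?thesis
  proof (rule Lim_transform_eventually)
    show "\<forall>\<^sub>F k in sequentially. ereal (real k * (\<Sum>j<k. 1 / (2 * real j + 1))
        - real k / 2 * (ln (real k) + ln 4 + euler_mascheroni))
      = enn2ereal (expected_absorption_time k k)
        - ereal (real k / 2 * (ln (real k) + ln 4 + euler_mascheroni))"
      using eventually_gt_at_top[of 0]
    proof eventually_elim
      case (elim k)
      have "mean_time k 0 = real k * (\<Sum>j<k. 1 / (2 * real j + 1))"
        by (simp add: mean_time_def sum_gap flip: lessThan_atLeast0)
      \<comment> \<open>For positive \<open>k\<close> the expectation is a finite nonnegative real,
        so the extended-real difference is the real one.\<close>
      then show ?case
        using mean_time_nonneg[of k 0] by (simp add: expected_absorption_time_diagonal[OF elim])
    qed
  qed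
qed

end
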